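(* For all $n\ge 0$ let $S_n(2413,3142,P_3)$ be the set of permutations of $[n]$ (including the empty permutation for $n=0$) that avoid the classical patterns $2413$ and $3142$ and the partially ordered pattern $P_3$. Then $$F_3(x,p,q,u,v,s,t)=\sum_{n\geq 0}x^n\sum_{\sigma \in S_n(2413,3142,P_3)}p^{\mathrm{asc}(\sigma)}q^{\mathrm{des}(\sigma)}u^{\mathrm{lrmax}(\sigma)}v^{\mathrm{rlmax}(\sigma)}s^{\mathrm{lrmin}(\sigma)}t^{\mathrm{rlmin}(\sigma)}$$ is given by $$F_3=\frac{1+q^2v^2sx^2+vtusx(1+ptux)-qvx\left(1+pus^2x^2vt(-1+t)(-1+u)+s(1+px+vtux)\right)}{1+q^2v^2sx^2-qvx(1+s+psx)}.$$
   Context: A permutation $\pi=\pi_1\cdots\pi_n$ avoids a classical pattern $p=p_1\cdots p_k$ if there is no subsequence $\pi_{i_1}\cdots\pi_{i_k}$ ($i_1<\cdots<i_k$) order-isomorphic to $p$. For $k\ge1$, $P_k$ is the partially ordered pattern of length $k$ whose poset on $\{1,\dots,k\}$ has $k$ greater than each of $1,\dots,k-1$ and $1,\dots,k-1$ pairwise incomparable; a permutation $\pi$ avoids $P_k$ iff there are no indices $i_1<\cdots<i_k$ with $\pi_{i_j}<\pi_{i_k}$ for all $j<k$ (so avoiding $P_3$ is the same as avoiding both $123$ and $213$). Statistics: $\mathrm{asc}(\pi)$ (resp. $\mathrm{des}(\pi)$) is the number of $i\in[n-1]$ with $\pi_i<\pi_{i+1}$ (resp. $\pi_i>\pi_{i+1}$);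 $\mathrm{lrmax}$, $\mathrm{rlmax}$, $\mathrm{lrmin}$, $\mathrm{rlmin}$ count left-to-right maxima, right-to-left maxima, left-to-right minima and right-to-left minima respectively ($\pi_i$ is a right-to-left maximum if it exceeds every entry to its right, etc.; $\pi_n$ is always a right-to-left maximum and minimum). The empty permutation contributes $1$. *)

theory Defs
  imports
    "HOL-Combinatorics.Multiset_Permutations"
    "HOL-Library.Sublist"
    "HOL-Computational_Algebra.Formal_Power_Series"
begin

text \<open>
  Permutations of \<open>[n]\<close> are given in one-line notation, as the elements of
  \<^term>\<open>permutations_of_set {1..n}\<close>.
\<close>

definition order_isomorphic :: "nat list \<Rightarrow> nat list \<Rightarrow> bool" where
  "order_isomorphic xs ys \<longleftrightarrow> length xs = length ys \<and>
     (\<forall>i<length xs. \<forall>j<length xs. xs ! i < xs ! j \<longleftrightarrow> ys ! i < ys ! j)"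

definition avoids :: "nat list \<Rightarrow> nat list \<Rightarrow> bool" where
  "avoids \<pi> p \<longleftrightarrow> \<not> (\<exists>\<tau>. subseq \<tau> \<pi> \<and> order_isomorphic \<tau> p)"

text \<open>
  A partially ordered pattern of length \<open>k\<close> is given by a strict order \<open>R\<close> on the
  positions \<open>{1..k}\<close>; the entries of an occurrence must respect \<open>R\<close>, entries at
  incomparable positions being unconstrained.  List indexing starts at \<open>0\<close>.
\<close>

definition avoids_pop :: "nat list \<Rightarrow> nat \<Rightarrow> (nat \<times> nat) set \<Rightarrow> bool" where
  "avoids_pop \<pi> k R \<longleftrightarrow>
     \<not> (\<exists>\<tau>. subseq \<tau> \<pi> \<and> length \<tau> = k \<and> (\<forall>(i, j)\<in>R. \<tau> ! (i - 1) < \<tau> ! (j - 1)))"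

definition P_poset :: "nat \<Rightarrow> (nat \<times> nat) set" where
  "P_poset k = {(i, k) |i. 1 \<le> i \<and> i < k}"

definition S_avoid :: "nat \<Rightarrow> nat \<Rightarrow> nat list set" where
  "S_avoid k n = {\<sigma> \<in> permutations_of_set {1..n}.
     avoids \<sigma> [2, 4, 1, 3] \<and> avoids \<sigma> [3, 1, 4, 2] \<and> avoids_pop \<sigma> k (P_poset k)}"

definition asc :: "nat list \<Rightarrow> nat" where
  "asc \<pi> = card {i. Suc i < length \<pi> \<and> \<pi> ! i < \<pi> ! Suc i}"

definition des :: "nat list \<Rightarrow> nat" where
  "des \<pi> = card {i. Suc i < length \<pi> \<and> \<pi> ! i > \<pi> ! Suc i}"

definition lrmax :: "nat list \<Rightarrow> nat" where
  "lrmax \<pi> = card {i. i < length \<pi> \<and> (\<forall>j<i. \<pi> ! j < \<pi> ! i)}"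

definition rlmax :: "nat list \<Rightarrow> nat" where
  "rlmax \<pi> = card {i. i < length \<pi> \<and> (\<forall>j. i < j \<and> j < length \<pi> \<longrightarrow> \<pi> ! j < \<pi> ! i)}"

definition lrmin :: "nat list \<Rightarrow> nat" where
  "lrmin \<pi> = card {i. i < length \<pi> \<and> (\<forall>j<i. \<pi> ! j > \<pi> ! i)}"

definition rlmin :: "nat list \<Rightarrow> nat" where
  "rlmin \<pi> = card {i. i < length \<pi> \<and> (\<forall>j. i < j \<and> j < length \<pi> \<longrightarrow> \<pi> ! j > \<pi> ! i)}"

text \<open>
  The generating function as a formal power series in \<open>x\<close>.  The remaining variables are
  arbitrary elements of an arbitrary field; since every coefficient is a polynomial in
  them, the case of indeterminates is the instance where the field is the field of
  rational functions in \<open>p, q, u, v, s, t\<close>.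
\<close>

definition F :: "nat \<Rightarrow> 'a::field \<Rightarrow> 'a \<Rightarrow> 'a \<Rightarrow> 'a \<Rightarrow> 'a \<Rightarrow> 'a \<Rightarrow> 'a fps" where
  "F k p q u v s t = Abs_fps (\<lambda>n. \<Sum>\<sigma>\<in>S_avoid k n.
     p ^ asc \<sigma> * q ^ des \<sigma> * u ^ lrmax \<sigma> * v ^ rlmax \<sigma> * s ^ lrmin \<sigma> * t ^ rlmin \<sigma>)"

end

theory Submission
  imports Defs
begin

text \<open>
  If \<open>\<sigma>\<close> avoids \<open>P\<^sub>3\<close> and starts with \<open>a\<close>, then the entries above \<open>a\<close> precede those below \<open>a\<close>
  and decrease. Hence \<open>\<sigma> = a n (n-1) \<dots> (a+1) \<sigma>'\<close> with \<open>\<sigma>'\<close> an arbitrary \<open>P\<^sub>3\<close>-avoiding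
  permutation of \<open>[a-1]\<close>; the patterns 2413 and 3142 both contain \<open>P\<^sub>3\<close> and exclude nothing more.
  The six statistics behave simply under this skew sum: with \<open>B(u,t)\<close> the generating function of the
  single blocks \<open>a n (n-1) \<dots> (a+1)\<close>, one gets \<open>F(u,t) = 1 + B(u,t) + q B(u,1) (F(1,t) - 1)\<close>,
  and \<open>B\<close> is a geometric series.
\<close>

section \<open>The block decomposition\<close>

text \<open>Fixing the first letter of a possible occurrence turns the three-letter condition into a
  pairwise one on the tail, which suits \<open>sorted_wrt\<close> and induction on lists.\<close>

fun P3_free :: "nat list \<Rightarrow> bool" where
  "P3_free [] \<longleftrightarrow> True"
| "P3_free (a # xs) \<longleftrightarrow> sorted_wrt (\<lambda>y z. \<not> (a < z \<and> y < z)) xs \<and> P3_free xs"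

lemma subseq_Cons_Cons:
  "subseq (x # ys) (a # xs) \<longleftrightarrow> subseq (x # ys) xs \<or> x = a \<and> subseq ys xs"
  by (cases "x = a") (auto dest: subseq_Cons')

lemma sorted_wrt_iff_subseq: "sorted_wrt R xs \<longleftrightarrow> (\<forall>y z. subseq [y, z] xs \<longrightarrow> R y z)"
proof (induction xs)
  case (Cons a xs)
  then show ?case
    by (simp only: sorted_wrt.simps subseq_Cons_Cons subseq_singleton_left) blast
qed simp

text \<open>An occurrence either uses the head, leaving a pair in the tail, or lies wholly in the
  tail.\<close>

lemma P3_free_iff_subseq:
  "P3_free xs \<longleftrightarrow> (\<forall>x y z. subseq [x, y, z] xs \<longrightarrow> \<not> (x < z \<and> y < z))"
proof (induction xs)
  case (Cons a xs)
  then show ?case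
    by (simp only: P3_free.simps sorted_wrt_iff_subseq subseq_Cons_Cons[of _ "[_, _]"]) blast
qed simp

lemma avoids_pop_P3: "avoids_pop xs 3 (P_poset 3) \<longleftrightarrow> P3_free xs"
proof -
  have P: "P_poset 3 = {(1, 3), (2, 3)}"
    unfolding P_poset_def by auto
  have L: "length \<tau> = 3 \<longleftrightarrow> (\<exists>x y z. \<tau> = [x, y, z])" for \<tau> :: "nat list"
    by (auto simp: numeral_eq_Suc length_Suc_conv)
  show ?thesis
    unfolding avoids_pop_def P3_free_iff_subseq P L by fastforce
qed

lemma P3_free_subseq: "subseq xs ys \<Longrightarrow> P3_free ys \<Longrightarrow> P3_free xs"
  unfolding P3_free_iff_subseq by (meson subseq_order.trans)

text \<open>The assumption on \<open>p\<close> places an occurrence of P3 at its positions 0, 2, 3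
  or 0, 1, 2 (counted from 0), and every copy of \<open>p\<close> inherits it. The first case fits
  2413, the second 3142.\<close>

lemma P3_free_avoids:
  assumes "P3_free xs" and len: "length p = 4"
    and nth: "p ! 0 < p ! 3 \<and> p ! 2 < p ! 3 \<or> p ! 0 < p ! 2 \<and> p ! 1 < p ! 2"
  shows "avoids xs p"
proof (rule ccontr)
  assume "\<not> avoids xs p"
  then obtain \<tau> where sub: "subseq \<tau> xs" and iso: "order_isomorphic \<tau> p"
    unfolding avoids_def by blast
  have "length \<tau> = 4" and lt: "\<And>i j. i < 4 \<Longrightarrow> j < 4 \<Longrightarrow> \<tau> ! i < \<tau> ! j \<longleftrightarrow> p ! i < p ! j"
    using iso len unfolding order_isomorphic_def by auto
  then obtain w x y z where \<tau>: "\<tau> = [w, x, y, z]"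
    by (auto simp: numeral_eq_Suc length_Suc_conv)
  have "w < z \<and> y < z \<or> w < y \<and> x < y"
    using nth lt[of 0 3] lt[of 2 3] lt[of 0 2] lt[of 1 2]
    by (auto simp: \<tau> numeral_eq_Suc)
  moreover have "subseq [w, y, z] \<tau>" "subseq [w, x, y] \<tau>"
    unfolding \<tau> by auto
  ultimately show False
    using \<open>P3_free xs\<close> sub unfolding P3_free_iff_subseq by (meson subseq_order.trans)
qed

lemma S_avoid_3: "S_avoid 3 n = {\<sigma> \<in> permutations_of_set {1..n}. P3_free \<sigma>}"
  unfolding S_avoid_def avoids_pop_P3 by (auto intro: P3_free_avoids)

section \<open>Adding and removing the first block\<close>

definition block :: "nat \<Rightarrow> nat \<Rightarrow> nat list" where
  "block a n = a # rev [Suc a..<Suc n]"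

text \<open>Each entry of \<open>ds\<close> exceeds everything after it, so it cannot start an
  occurrence.\<close>

lemma P3_free_decreasing_append:
  assumes "sorted_wrt (>) ds" "\<And>d y. d \<in> set ds \<Longrightarrow> y \<in> set ys \<Longrightarrow> y < d" "P3_free ys"
  shows "P3_free (ds @ ys)"
  using assms
proof (induction ds)
  case (Cons d ds)
  have "sorted_wrt (\<lambda>y z. \<not> (d < z \<and> y < z)) (ds @ ys)"
    using Cons.prems
    by (intro sorted_wrt_mono_rel[OF _ sorted_wrt_true]) (auto dest: less_asym)
  then show ?case using Cons by simp
qed simp

lemma P3_free_block_append:
  assumes "set ys \<subseteq> {1..a - 1}" "P3_free ys"
  shows "P3_free (block a n @ ys)"
proof -
  let ?ds = "rev [Suc a..<Suc n]"
  have dec: "sorted_wrt (>) ?ds"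
    by (simp add: sorted_wrt_rev strict_sorted_iff del: upt_Suc)
  have less: "y < d" if "d \<in> set ?ds" "y \<in> set ys" for d y
    using that assms(1) by fastforce
  \<comment> \<open>An occurrence starting with \<open>a\<close> needs its last letter inside
    \<open>?ds\<close>, since all of \<open>ys\<close> lies below \<open>a\<close>; but the entries
    of \<open>?ds\<close> in front of that letter are larger than it.\<close>
  have "sorted_wrt (\<lambda>y z. \<not> (a < z \<and> y < z)) (?ds @ ys)"
    unfolding sorted_wrt_append
  proof (intro conjI ballI)
    show "sorted_wrt (\<lambda>y z. \<not> (a < z \<and> y < z)) ?ds"
      by (rule sorted_wrt_mono_rel[OF _ dec]) auto
    show "sorted_wrt (\<lambda>y z. \<not> (a < z \<and> y < z)) ys"
      by (rule sorted_wrt_mono_rel[OF _ sorted_wrt_true]) (use assms(1) in fastforce)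
    show "\<not> (a < z \<and> y < z)" if "y \<in> set ?ds" "z \<in> set ys" for y z
      using less[OF that] by simp
  qed
  then show ?thesis
    using P3_free_decreasing_append[OF dec less assms(2)] unfolding block_def by simp
qed

text \<open>The relation says that once \<open>P\<close> fails it fails for good, so the entries
  satisfying \<open>P\<close> form a prefix.\<close>

lemma append_filter_of_sorted_wrt:
  assumes "sorted_wrt (\<lambda>y z. P z \<longrightarrow> P y) xs"
  shows "xs = filter P xs @ filter (\<lambda>x. \<not> P x) xs"
  using assms
proof (induction xs)
  case (Cons a xs)
  show ?case
  proof (cases "P a")
    case False
    then have "\<forall>x\<in>set xs. \<not> P x" using Cons.prems by auto
    then show ?thesis using False by (auto simp: filter_empty_conv filter_id_conv)
  qed (use Cons in auto)
qed simp

lemma P3_free_permutation_cases: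
  assumes \<sigma>: "\<sigma> \<in> permutations_of_set {1..n}" and free: "P3_free \<sigma>" and "n > 0"
  obtains a \<tau> where "a \<in> {1..n}" "\<tau> \<in> permutations_of_set {1..a - 1}" "P3_free \<tau>"
    "\<sigma> = block a n @ \<tau>"
proof -
  from \<sigma> have set: "set \<sigma> = {1..n}" and dist: "distinct \<sigma>"
    by (auto simp: permutations_of_set_def)
  with \<open>n > 0\<close> obtain a xs where eq: "\<sigma> = a # xs"
    by (cases \<sigma>) auto
  have a: "a \<in> {1..n}" and a': "a \<notin> set xs" and xs: "set xs = {1..n} - {a}" "distinct xs"
    using set dist unfolding eq by auto
  have sw: "sorted_wrt (\<lambda>y z. \<not> (a < z \<and> y < z)) xs" and free': "P3_free xs"
    using free unfolding eq by auto
  define hi lo where "hi = filter (\<lambda>x. x > a) xs" and "lo = filter (\<lambda>x. \<not> x > a) xs"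
  \<comment> \<open>An entry below \<open>a\<close> standing before one above \<open>a\<close> would
    complete an occurrence with the leading \<open>a\<close>.\<close>
  have "sorted_wrt (\<lambda>y z. z > a \<longrightarrow> y > a) xs"
    by (rule sorted_wrt_mono_rel[OF _ sw]) (use a' in \<open>auto simp: not_less le_less\<close>)
  then have split: "xs = hi @ lo"
    unfolding hi_def lo_def by (rule append_filter_of_sorted_wrt)
  have "sorted_wrt (\<lambda>y z. \<not> (a < z \<and> y < z)) hi"
    using sw unfolding hi_def by (rule sorted_wrt_filter)
  \<comment> \<open>All of \<open>hi\<close> exceeds \<open>a\<close>, so \<open>a < z\<close> is
    automatic and only the ban on \<open>y < z\<close> remains.\<close>
  then have "sorted_wrt (\<ge>) hi"
    by (rule sorted_wrt_mono_rel[rotated]) (auto simp: hi_def)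
  then have "sorted (rev hi)"
    by (simp add: sorted_wrt_rev)
  moreover have "set (rev hi) = {Suc a..<Suc n}"
    using a unfolding hi_def set_rev set_filter xs(1) by auto
  moreover have "distinct (rev hi)"
    using xs by (simp add: hi_def)
  ultimately have "rev hi = [Suc a..<Suc n]"
    by (intro sorted_distinct_set_unique) (auto simp del: upt_Suc)
  then have hi: "hi = rev [Suc a..<Suc n]"
    by (metis rev_rev_ident)
  have "set lo = {1..a - 1}"
    using a unfolding lo_def set_filter xs(1) by auto
  then have "lo \<in> permutations_of_set {1..a - 1}"
    using xs(2) by (simp add: permutations_of_set_def lo_def)
  moreover have "P3_free lo"
    by (rule P3_free_subseq[OF _ free']) (simp add: lo_def)
  ultimately show ?thesis
    using that[of a lo] a unfolding eq split hi block_def by simp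
qed

lemma S_avoid_3_0: "S_avoid 3 0 = {[]}"
  by (auto simp: S_avoid_3)

lemma block_append_in_permutations:
  assumes "a \<in> {1..n}" "\<tau> \<in> permutations_of_set {1..a - 1}"
  shows "block a n @ \<tau> \<in> permutations_of_set {1..n}"
  using assms by (auto simp: permutations_of_set_def block_def simp del: upt_Suc)

text \<open>The first entry of the image gives back \<open>a\<close>, hence the block and the
  remainder, so the map is injective. Surjectivity is the decomposition of a nonempty permutation;
  for \<open>a = 1\<close> the remainder is empty.\<close>

lemma S_avoid_3_bij:
  assumes "n > 0"
  shows "bij_betw (\<lambda>(a, \<tau>). block a n @ \<tau>) (SIGMA a:{1..n}. S_avoid 3 (a - 1)) (S_avoid 3 n)"
  unfolding bij_betw_def
proof (intro conjI equalityI subsetI)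
  show "inj_on (\<lambda>(a, \<tau>). block a n @ \<tau>) (SIGMA a:{1..n}. S_avoid 3 (a - 1))"
    by (rule inj_onI) (auto simp: block_def)
next
  fix \<sigma> assume "\<sigma> \<in> (\<lambda>(a, \<tau>). block a n @ \<tau>) ` (SIGMA a:{1..n}. S_avoid 3 (a - 1))"
  then obtain a \<tau> where "a \<in> {1..n}" "\<tau> \<in> S_avoid 3 (a - 1)" "\<sigma> = block a n @ \<tau>"
    by auto
  moreover from this have "set \<tau> \<subseteq> {1..a - 1}"
    by (auto simp: S_avoid_3 permutations_of_set_def)
  ultimately show "\<sigma> \<in> S_avoid 3 n"
    using block_append_in_permutations[of a n \<tau>] P3_free_block_append[of \<tau> a n]
    by (simp add: S_avoid_3)
next
  fix \<sigma> assume "\<sigma> \<in> S_avoid 3 n"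
  then have "\<sigma> \<in> permutations_of_set {1..n}" "P3_free \<sigma>"
    by (simp_all add: S_avoid_3)
  then obtain a \<tau> where "a \<in> {1..n}" "\<tau> \<in> S_avoid 3 (a - 1)" "\<sigma> = block a n @ \<tau>"
    using assms unfolding S_avoid_3 by (rule P3_free_permutation_cases) blast
  then show "\<sigma> \<in> (\<lambda>(a, \<tau>). block a n @ \<tau>) ` (SIGMA a:{1..n}. S_avoid 3 (a - 1))"
    by force
qed

section \<open>Statistics of skew sums\<close>

lemma card_less_add:
  fixes m k :: nat
  shows "card {i. i < m + k \<and> P i} = card {i. i < m \<and> P i} + card {i. i < k \<and> P (m + i)}"
proof -
  have "{i. i < m + k \<and> P i} = {i. i < m \<and> P i} \<union> (+) m ` {i. i < k \<and> P (m + i)}"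
  proof (intro equalityI subsetI)
    fix i assume "i \<in> {i. i < m + k \<and> P i}"
    then show "i \<in> {i. i < m \<and> P i} \<union> (+) m ` {i. i < k \<and> P (m + i)}"
      by (cases "i < m") (auto intro!: image_eqI[of _ _ "i - m"])
  qed auto
  also have "card \<dots> = card {i. i < m \<and> P i} + card ((+) m ` {i. i < k \<and> P (m + i)})"
    by (rule card_Un_disjoint) auto
  finally show ?thesis
    by (simp add: card_image)
qed

text \<open>A common form of \<open>asc\<close> and \<open>des\<close>, so that the junction of two
  lists is analysed only once.\<close>

definition adj_count :: "(nat \<Rightarrow> nat \<Rightarrow> bool) \<Rightarrow> nat list \<Rightarrow> nat" where
  "adj_count R xs = card {i. Suc i < length xs \<and> R (xs ! i) (xs ! Suc i)}"

lemma adj_count_append: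
  assumes "xs \<noteq> []" "ys \<noteq> []"
  shows "adj_count R (xs @ ys) = adj_count R xs + (if R (last xs) (hd ys) then 1 else 0) + adj_count R ys"
proof -
  obtain m k where m: "length xs = Suc m" and k: "length ys = Suc k"
    using assms by (meson length_0_conv not0_implies_Suc)
  let ?P = "\<lambda>i. R ((xs @ ys) ! i) ((xs @ ys) ! Suc i)"
  have "adj_count R (xs @ ys) = card {i. i < Suc m + k \<and> ?P i}"
    by (simp add: adj_count_def m k)
  \<comment> \<open>The positions split into \<open>m\<close> adjacencies inside \<open>xs\<close>,
    the junction at position \<open>m\<close>, and \<open>k\<close> adjacencies inside
    \<open>ys\<close>.\<close>
  also have "\<dots> = card {i. i < m + 1 \<and> ?P i} + card {i. i < k \<and> ?P (Suc m + i)}"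
    unfolding Suc_eq_plus1 by (rule card_less_add)
  also have "card {i. i < m + 1 \<and> ?P i} = card {i. i < m \<and> ?P i} + card {i. i < 1 \<and> ?P (m + i)}"
    by (rule card_less_add)
  also have "{i. i < m \<and> ?P i} = {i. Suc i < length xs \<and> R (xs ! i) (xs ! Suc i)}"
    by (auto simp: m nth_append)
  also have "{i. i < 1 \<and> ?P (m + i)} = (if R (last xs) (hd ys) then {0} else {})"
    using assms by (auto simp: m nth_append last_conv_nth hd_conv_nth)
  also have "{i. i < k \<and> ?P (Suc m + i)} = {i. Suc i < length ys \<and> R (ys ! i) (ys ! Suc i)}"
    by (auto simp: m k nth_append)
  finally show ?thesis
    by (simp add: adj_count_def)
qed

lemma asc_eq: "asc = adj_count (<)" and des_eq: "des = adj_count (>)"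
  by (auto simp: asc_def des_def adj_count_def fun_eq_iff)

text \<open>Every position to the right of one in \<open>ys\<close> is again in \<open>ys\<close>.
  This serves both right-to-left statistics, with \<open>P\<close> the comparison with a fixed
  entry.\<close>

lemma all_later_append_right:
  "(\<forall>j. length xs + i < j \<and> j < length xs + length ys \<longrightarrow> P ((xs @ ys) ! j)) \<longleftrightarrow>
   (\<forall>j. i < j \<and> j < length ys \<longrightarrow> P (ys ! j))"
proof
  assume *: "\<forall>j. length xs + i < j \<and> j < length xs + length ys \<longrightarrow> P ((xs @ ys) ! j)"
  show "\<forall>j. i < j \<and> j < length ys \<longrightarrow> P (ys ! j)"
    using *[rule_format, of "length xs + j" for j] by auto
next
  assume *: "\<forall>j. i < j \<and> j < length ys \<longrightarrow> P (ys ! j)"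
  show "\<forall>j. length xs + i < j \<and> j < length xs + length ys \<longrightarrow> P ((xs @ ys) ! j)"
  proof (intro allI impI)
    fix j assume j: "length xs + i < j \<and> j < length xs + length ys"
    then have "i < j - length xs \<and> j - length xs < length ys"
      by linarith
    with * j show "P ((xs @ ys) ! j)"
      by (simp add: nth_append)
  qed
qed

section \<open>The six statistics on a skew sum\<close>

context
  fixes xs ys :: "nat list"
  assumes skew: "\<And>x y. x \<in> set xs \<Longrightarrow> y \<in> set ys \<Longrightarrow> y < x"
begin

lemma skew_nth: "i < length xs \<Longrightarrow> j < length ys \<Longrightarrow> ys ! j < xs ! i"
  by (simp add: skew)

lemma asc_skew: "xs \<noteq> [] \<Longrightarrow> ys \<noteq> [] \<Longrightarrow> asc (xs @ ys) = asc xs + asc ys"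
  using skew[of "last xs" "hd ys"] by (simp add: asc_eq adj_count_append)

text \<open>The last entry of \<open>xs\<close> exceeds the first of \<open>ys\<close>, so the
  junction is one extra descent.\<close>

lemma des_skew: "xs \<noteq> [] \<Longrightarrow> ys \<noteq> [] \<Longrightarrow> des (xs @ ys) = Suc (des xs + des ys)"
  using skew[of "last xs" "hd ys"] by (simp add: des_eq adj_count_append)

text \<open>The first entry of \<open>xs\<close> exceeds every entry of \<open>ys\<close> and keeps
  each of them from being a left-to-right maximum.\<close>

lemma lrmax_skew:
  assumes "xs \<noteq> []"
  shows "lrmax (xs @ ys) = lrmax xs"
proof -
  have "\<not> (\<forall>j<length xs + i. (xs @ ys) ! j < (xs @ ys) ! (length xs + i))" if "i < length ys" for i
    using skew_nth[of 0 i] that assms by (auto simp: nth_append intro!: exI[of _ 0])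
  then have "card {i. i < length ys \<and> (\<forall>j<length xs + i. (xs @ ys) ! j < (xs @ ys) ! (length xs + i))} = 0"
    by simp
  moreover have "{i. i < length xs \<and> (\<forall>j<i. (xs @ ys) ! j < (xs @ ys) ! i)} =
      {i. i < length xs \<and> (\<forall>j<i. xs ! j < xs ! i)}"
    by (auto simp: nth_append)
  ultimately show ?thesis
    unfolding lrmax_def length_append card_less_add by simp
qed

text \<open>The entries of \<open>xs\<close> are larger and cannot obstruct a minimum in
  \<open>ys\<close>; nothing of \<open>ys\<close> stands to the left of \<open>xs\<close>.\<close>

lemma lrmin_skew: "lrmin (xs @ ys) = lrmin xs + lrmin ys"
proof -
  have "(\<forall>j<length xs + i. (xs @ ys) ! j > (xs @ ys) ! (length xs + i)) \<longleftrightarrow> (\<forall>j<i. ys ! j > ys ! i)"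
    if i: "i < length ys" for i
  proof
    assume *: "\<forall>j<length xs + i. (xs @ ys) ! j > (xs @ ys) ! (length xs + i)"
    show "\<forall>j<i. ys ! j > ys ! i"
      using *[rule_format, of "length xs + j" for j] by auto
  next
    assume *: "\<forall>j<i. ys ! j > ys ! i"
    then show "\<forall>j<length xs + i. (xs @ ys) ! j > (xs @ ys) ! (length xs + i)"
      using i skew_nth by (auto simp: nth_append)
  qed
  then have "{i. i < length ys \<and> (\<forall>j<length xs + i. (xs @ ys) ! j > (xs @ ys) ! (length xs + i))} =
      {i. i < length ys \<and> (\<forall>j<i. ys ! j > ys ! i)}"
    by blast
  moreover have "{i. i < length xs \<and> (\<forall>j<i. (xs @ ys) ! j > (xs @ ys) ! i)} =
      {i. i < length xs \<and> (\<forall>j<i. xs ! j > xs ! i)}"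
    by (auto simp: nth_append)
  ultimately show ?thesis
    unfolding lrmin_def length_append card_less_add by simp
qed

text \<open>The entries of \<open>ys\<close> are smaller and cannot obstruct a maximum in
  \<open>xs\<close>; nothing of \<open>xs\<close> stands to the right of \<open>ys\<close>.\<close>

lemma rlmax_skew: "rlmax (xs @ ys) = rlmax xs + rlmax ys"
proof -
  have "(\<forall>j. i < j \<and> j < length xs + length ys \<longrightarrow> (xs @ ys) ! j < (xs @ ys) ! i) \<longleftrightarrow>
      (\<forall>j. i < j \<and> j < length xs \<longrightarrow> xs ! j < xs ! i)" if i: "i < length xs" for i
  proof
    assume *: "\<forall>j. i < j \<and> j < length xs + length ys \<longrightarrow> (xs @ ys) ! j < (xs @ ys) ! i"
    show "\<forall>j. i < j \<and> j < length xs \<longrightarrow> xs ! j < xs ! i"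
    proof (intro allI impI)
      fix j assume "i < j \<and> j < length xs"
      then show "xs ! j < xs ! i"
        using *[rule_format, of j] i by (simp add: nth_append)
    qed
  next
    assume "\<forall>j. i < j \<and> j < length xs \<longrightarrow> xs ! j < xs ! i"
    then show "\<forall>j. i < j \<and> j < length xs + length ys \<longrightarrow> (xs @ ys) ! j < (xs @ ys) ! i"
      using i skew_nth by (auto simp: nth_append)
  qed
  then have "{i. i < length xs \<and> (\<forall>j. i < j \<and> j < length xs + length ys \<longrightarrow> (xs @ ys) ! j < (xs @ ys) ! i)} =
      {i. i < length xs \<and> (\<forall>j. i < j \<and> j < length xs \<longrightarrow> xs ! j < xs ! i)}"
    by blast
  then show ?thesis
    unfolding rlmax_def length_append card_less_add nth_append_length_plus
    by (simp add: all_later_append_right[where P = "\<lambda>z. z < _"])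
qed

text \<open>The first entry of \<open>ys\<close>, at position \<open>length xs\<close>, is smaller
  than every entry of \<open>xs\<close> and to its right.\<close>

lemma rlmin_skew:
  assumes "ys \<noteq> []"
  shows "rlmin (xs @ ys) = rlmin ys"
proof -
  have "\<not> (\<forall>j. i < j \<and> j < length xs + length ys \<longrightarrow> (xs @ ys) ! j > (xs @ ys) ! i)"
    if "i < length xs" for i
    using skew_nth[of i 0] that assms
    by (auto simp: nth_append intro!: exI[of _ "length xs"])
  then have "card {i. i < length xs \<and> (\<forall>j. i < j \<and> j < length xs + length ys \<longrightarrow> (xs @ ys) ! j > (xs @ ys) ! i)} = 0"
    by simp
  then show ?thesis
    unfolding rlmin_def length_append card_less_add nth_append_length_plus
    by (simp add: all_later_append_right[where P = "\<lambda>z. z > _"])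
qed

end

section \<open>Statistics of a block\<close>

lemma length_block: "a \<le> n \<Longrightarrow> length (block a n) = Suc (n - a)"
  by (simp add: block_def del: upt_Suc)

lemma nth_block: "i \<le> n - a \<Longrightarrow> block a n ! i = (if i = 0 then a else Suc n - i)"
  by (cases i) (auto simp: block_def rev_nth nth_Cons' simp del: upt_Suc)

text \<open>For \<open>a = n\<close> the decreasing run is empty. This case stands apart because the
  formulas for longer blocks do not extend to it.\<close>

lemma block_stats_1:
  "asc (block n n) = 0" "des (block n n) = 0" "lrmax (block n n) = 1" "rlmax (block n n) = 1"
  "lrmin (block n n) = 1" "rlmin (block n n) = 1"
  by (auto simp: asc_def des_def lrmax_def rlmax_def lrmin_def rlmin_def block_def card_1_singleton_iff)

text \<open>The block reads \<open>a, n, n-1, ..., a+1\<close>: one ascent, then only descents.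
  Left-to-right maxima are \<open>a\<close> and \<open>n\<close>, right-to-left minima are
  \<open>a\<close> and \<open>a+1\<close>, and every entry except \<open>a\<close> is a
  right-to-left maximum.\<close>

lemma block_stats:
  assumes "a < n"
  shows "asc (block a n) = 1" "des (block a n) = n - a - 1" "lrmax (block a n) = 2"
    "rlmax (block a n) = n - a" "lrmin (block a n) = 1" "rlmin (block a n) = 2"
proof -
  have len: "length (block a n) = Suc (n - a)"
    using assms by (simp add: length_block)
  have "{i. Suc i < length (block a n) \<and> block a n ! i < block a n ! Suc i} = {0}"
    using assms unfolding len by (auto simp: nth_block split: if_splits)
  then show "asc (block a n) = 1" by (simp add: asc_def)
  have "{i. Suc i < length (block a n) \<and> block a n ! i > block a n ! Suc i} = {1..<n - a}"
    using assms unfolding len by (auto simp: nth_block split: if_splits)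
  then show "des (block a n) = n - a - 1" by (simp add: des_def)
  have "{i. i < length (block a n) \<and> (\<forall>j<i. block a n ! j < block a n ! i)} = {0, 1}"
  proof (intro equalityI subsetI)
    fix i assume i: "i \<in> {i. i < length (block a n) \<and> (\<forall>j<i. block a n ! j < block a n ! i)}"
    show "i \<in> {0, 1}"
    proof (rule ccontr)
      assume "i \<notin> {0, 1}"
      \<comment> \<open>Position 1 holds \<open>n\<close>, which no later entry exceeds.\<close>
      then have "block a n ! 1 < block a n ! i" using i by auto
      then show False using i assms \<open>i \<notin> {0, 1}\<close> unfolding len by (auto simp: nth_block)
    qed
  qed (use assms in \<open>auto simp: len nth_block\<close>)
  then show "lrmax (block a n) = 2" by (simp add: lrmax_def)
  have "{i. i < length (block a n) \<and> (\<forall>j. i < j \<and> j < length (block a n) \<longrightarrow> block a n ! j < block a n ! i)} = {1..n - a}"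
  proof (intro equalityI subsetI)
    fix i assume i: "i \<in> {i. i < length (block a n) \<and> (\<forall>j. i < j \<and> j < length (block a n) \<longrightarrow> block a n ! j < block a n ! i)}"
    have "i \<noteq> 0"
    proof
      assume "i = 0"
      then have "block a n ! 1 < block a n ! 0" using i assms unfolding len by auto
      then show False using assms by (auto simp: nth_block)
    qed
    then show "i \<in> {1..n - a}" using i unfolding len by auto
  qed (use assms in \<open>auto simp: len nth_block\<close>)
  then show "rlmax (block a n) = n - a" by (simp add: rlmax_def)
  have "{i. i < length (block a n) \<and> (\<forall>j<i. block a n ! j > block a n ! i)} = {0}"
    using assms unfolding len by (force simp: nth_block split: if_splits)
  then show "lrmin (block a n) = 1" by (simp add: lrmin_def)
  have "{i. i < length (block a n) \<and> (\<forall>j. i < j \<and> j < length (block a n) \<longrightarrow> block a n ! j > block a n ! i)} = {0, n - a}"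
  proof (intro equalityI subsetI)
    fix i assume i: "i \<in> {i. i < length (block a n) \<and> (\<forall>j. i < j \<and> j < length (block a n) \<longrightarrow> block a n ! j > block a n ! i)}"
    show "i \<in> {0, n - a}"
    proof (rule ccontr)
      assume "i \<notin> {0, n - a}"
      \<comment> \<open>Position \<open>n - a\<close> is the last one and holds
        \<open>a + 1\<close>, smaller than every other entry except \<open>a\<close>.\<close>
      then have "block a n ! (n - a) > block a n ! i" using i unfolding len by auto
      then show False using i assms \<open>i \<notin> {0, n - a}\<close> unfolding len by (auto simp: nth_block)
    qed
  qed (use assms in \<open>auto simp: len nth_block\<close>)
  then show "rlmin (block a n) = 2" using assms by (simp add: rlmin_def)
qed

section \<open>The generating function\<close>

unbundle fps_syntax

section \<open>Weights and the recurrence for the coefficients\<close>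

definition weight :: "'a::field \<Rightarrow> 'a \<Rightarrow> 'a \<Rightarrow> 'a \<Rightarrow> 'a \<Rightarrow> 'a \<Rightarrow> nat list \<Rightarrow> 'a" where
  "weight p q u v s t \<sigma> =
     p ^ asc \<sigma> * q ^ des \<sigma> * u ^ lrmax \<sigma> * v ^ rlmax \<sigma> * s ^ lrmin \<sigma> * t ^ rlmin \<sigma>"

lemma F_nth: "F k p q u v s t $ n = sum (weight p q u v s t) (S_avoid k n)"
  by (simp add: F_def weight_def)

lemma weight_Nil: "weight p q u v s t [] = 1"
  by (simp add: weight_def asc_def des_def lrmax_def rlmax_def lrmin_def rlmin_def)

text \<open>Left-to-right maxima come only from \<open>xs\<close> and right-to-left minima only from
  \<open>ys\<close>, so \<open>u\<close> or \<open>t\<close> becomes 1 in the other factor. The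
  leading \<open>q\<close> records the descent at the junction.\<close>

lemma weight_skew:
  assumes "\<And>x y. x \<in> set xs \<Longrightarrow> y \<in> set ys \<Longrightarrow> y < x" "xs \<noteq> []" "ys \<noteq> []"
  shows "weight p q u v s t (xs @ ys) = q * weight p q u v s 1 xs * weight p q 1 v s t ys"
  using assms
  by (simp add: weight_def asc_skew des_skew lrmax_skew rlmax_skew lrmin_skew rlmin_skew power_add)

text \<open>Here \<open>m\<close> is the length of the block. The value 0 at \<open>m = 0\<close>,
  where there is no block, gives the series of these weights a zero constant term.\<close>

definition block_weight :: "'a::field \<Rightarrow> 'a \<Rightarrow> 'a \<Rightarrow> 'a \<Rightarrow> 'a \<Rightarrow> 'a \<Rightarrow> nat \<Rightarrow> 'a" where
  "block_weight p q u v s t m =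
     (if m = 0 then 0 else if m = 1 then u * t * s * v
      else p * q ^ (m - 2) * u\<^sup>2 * t\<^sup>2 * s * v ^ (m - 1))"

lemma weight_block:
  assumes "a \<le> n"
  shows "weight p q u v s t (block a n) = block_weight p q u v s t (Suc n - a)"
proof (cases "a = n")
  case False
  then show ?thesis
    using assms by (simp add: weight_def block_stats block_weight_def Suc_diff_le numeral_2_eq_2)
qed (simp add: weight_def block_stats_1 block_weight_def)

text \<open>The sum runs over the length \<open>a\<close> of the remainder after the first block. An
  empty remainder gives the separate term, since the skew-sum formula needs both parts
  nonempty.\<close>

lemma F_3_nth_recurrence:
  assumes "n > 0"
  shows "F 3 p q u v s t $ n = block_weight p q u v s t n +
    q * (\<Sum>a\<in>{1..<n}. block_weight p q u v s 1 (n - a) * F 3 p q 1 v s t $ a)"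
proof -
  let ?w = "weight p q u v s t"
  have fin: "finite (S_avoid 3 k)" for k
    by (simp add: S_avoid_3)
  have "F 3 p q u v s t $ n = (\<Sum>(a, \<tau>)\<in>(SIGMA a:{1..n}. S_avoid 3 (a - 1)). ?w (block a n @ \<tau>))"
    unfolding F_nth sum.reindex_bij_betw[OF S_avoid_3_bij[OF assms], symmetric]
    by (simp add: case_prod_unfold)
  also have "\<dots> = (\<Sum>a\<in>{1..n}. \<Sum>\<tau>\<in>S_avoid 3 (a - 1). ?w (block a n @ \<tau>))"
    by (simp add: sum.Sigma fin)
  \<comment> \<open>The first entry 1 leaves an empty remainder and is split off; the other indices
    are shifted so that \<open>a\<close> becomes the length of the remainder.\<close>
  also have "{1..n} = insert 1 (Suc ` {1..<n})"
    using assms by (auto simp: image_Suc_atLeastLessThan)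
  also have "(\<Sum>a\<in>\<dots>. \<Sum>\<tau>\<in>S_avoid 3 (a - 1). ?w (block a n @ \<tau>)) =
      ?w (block 1 n) + (\<Sum>a\<in>{1..<n}. \<Sum>\<tau>\<in>S_avoid 3 a. ?w (block (Suc a) n @ \<tau>))"
    by (subst sum.insert; (subst sum.reindex)?)
      (auto simp: S_avoid_3_0 simp del: image_Suc_atLeastLessThan)
  also have "?w (block 1 n) = block_weight p q u v s t n"
    using weight_block[of 1 n] assms by simp
  finally have eq: "F 3 p q u v s t $ n = block_weight p q u v s t n +
      (\<Sum>a\<in>{1..<n}. \<Sum>\<tau>\<in>S_avoid 3 a. ?w (block (Suc a) n @ \<tau>))" .
  have "(\<Sum>\<tau>\<in>S_avoid 3 a. ?w (block (Suc a) n @ \<tau>)) =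
      q * (block_weight p q u v s 1 (n - a) * F 3 p q 1 v s t $ a)" if a: "a \<in> {1..<n}" for a
  proof -
    have "?w (block (Suc a) n @ \<tau>) = q * block_weight p q u v s 1 (n - a) * weight p q 1 v s t \<tau>"
      if \<tau>: "\<tau> \<in> S_avoid 3 a" for \<tau>
    proof -
      have set: "set \<tau> = {1..a}"
        using \<tau> by (simp add: S_avoid_3 permutations_of_set_def)
      have "?w (block (Suc a) n @ \<tau>) =
          q * weight p q u v s 1 (block (Suc a) n) * weight p q 1 v s t \<tau>"
      proof (rule weight_skew)
        show "block (Suc a) n \<noteq> []" by (simp add: block_def)
        show "\<tau> \<noteq> []" using set a by auto
        show "y < x" if "x \<in> set (block (Suc a) n)" "y \<in> set \<tau>" for x y
          using that set by (auto simp: block_def simp del: upt_Suc)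
      qed
      then show ?thesis
        using weight_block[of "Suc a" n p q u v s 1] a by simp
    qed
    then show ?thesis
      by (simp add: F_nth sum_distrib_left mult.assoc)
  qed
  then show ?thesis
    by (simp add: eq sum_distrib_left)
qed

section \<open>Functional equation and the geometric series\<close>

definition block_gf :: "'a::field \<Rightarrow> 'a \<Rightarrow> 'a \<Rightarrow> 'a \<Rightarrow> 'a \<Rightarrow> 'a \<Rightarrow> 'a fps" where
  "block_gf p q u v s t = Abs_fps (block_weight p q u v s t)"

text \<open>The sum in the recurrence is a Cauchy product; subtracting 1 removes the empty
  remainder.\<close>

lemma F_3_functional_equation:
  "F 3 p q u v s t =
     1 + block_gf p q u v s t + fps_const q * block_gf p q u v s 1 * (F 3 p q 1 v s t - 1)"
proof (rule fps_ext)
  fix n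
  let ?B = "block_gf p q u v s 1" and ?G = "F 3 p q 1 v s t - 1"
  have F0: "F 3 p q u v s t $ 0 = 1" for u
    by (simp add: F_nth S_avoid_3_0 weight_Nil)
  have B0: "block_gf p q u v s t $ 0 = 0" for t
    by (simp add: block_gf_def block_weight_def)
  show "F 3 p q u v s t $ n =
     (1 + block_gf p q u v s t + fps_const q * ?B * ?G) $ n"
  proof (cases "n = 0")
    case True
    then show ?thesis by (simp add: F0 B0 fps_mult_nth_0)
  next
    case False
    have "(?B * ?G) $ n = (\<Sum>a\<in>{0..n}. ?G $ a * ?B $ (n - a))"
      by (simp only: mult.commute[of ?B] fps_mult_nth)
    \<comment> \<open>The zero constant term of \<open>?G\<close> drops \<open>a = 0\<close>, that
      of \<open>?B\<close> drops \<open>a = n\<close>.\<close>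
    also have "\<dots> = (\<Sum>a\<in>{1..<n}. ?G $ a * ?B $ (n - a))"
      by (rule sum.mono_neutral_right) (auto simp: F0 B0 not_less Suc_le_eq)
    also have "\<dots> = (\<Sum>a\<in>{1..<n}. block_weight p q u v s 1 (n - a) * F 3 p q 1 v s t $ a)"
      by (rule sum.cong) (auto simp: block_gf_def)
    finally show ?thesis
      using False F_3_nth_recurrence[of n p q u v s t]
      by (simp add: mult.assoc block_gf_def)
  qed
qed

text \<open>From degree 2 on the coefficients are geometric with ratio \<open>q * v\<close>, so
  multiplication by \<open>1 - q v x\<close> leaves a polynomial of degree at most 2.\<close>

lemma block_gf_closed:
  "(1 - fps_const q * fps_const v * fps_X) * block_gf p q u v s t =
     fps_const u * fps_const t * fps_const s * fps_const v * fps_X * (1 - fps_const q * fps_const v * fps_X)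
     + fps_const p * fps_const u ^ 2 * fps_const t ^ 2 * fps_const s * fps_const v * fps_X ^ 2"
    (is "?lhs = ?rhs")
proof -
  have eq: "?lhs = block_gf p q u v s t - fps_const (q * v) * (fps_X * block_gf p q u v s t)"
    "?rhs = fps_const (u * t * s * v) * fps_X
       + fps_const (p * u\<^sup>2 * t\<^sup>2 * s * v - u * t * s * v * q * v) * fps_X ^ 2"
    by (simp_all add: algebra_simps power2_eq_square flip: fps_const_mult fps_const_sub)
  show ?thesis
    unfolding eq
  proof (rule fps_ext)
    fix n :: nat
    \<comment> \<open>Degrees 0 to 2 involve the initial values; from degree 3 on both coefficients
      involved are in the geometric range and cancel.\<close>
    have "n = 0 \<or> n = 1 \<or> n = 2 \<or> (\<exists>k. n = k + 3)"
      by presburger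
    then consider "n = 0" | "n = 1" | "n = 2" | k where "n = k + 3"
      by blast
    then show "(block_gf p q u v s t - fps_const (q * v) * (fps_X * block_gf p q u v s t)) $ n =
      (fps_const (u * t * s * v) * fps_X
       + fps_const (p * u\<^sup>2 * t\<^sup>2 * s * v - u * t * s * v * q * v) * fps_X ^ 2) $ n"
      by cases (simp_all add: block_gf_def block_weight_def fps_X_power_nth numeral_eq_Suc algebra_simps)
  qed
qed

text \<open>At \<open>u = 1\<close> the functional equation is a linear equation for
  \<open>g\<close> alone; its solution is substituted into the equation for \<open>f\<close>.
  Denominators stay cleared until the end.\<close>

theorem theorem2p1:
  fixes p q u v s t :: "'a::field"
  shows "F 3 p q u v s t =
    (let x = fps_X; P = fps_const p; Q = fps_const q; U = fps_const u;
         V = fps_const v; S = fps_const s; T = fps_const t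
     in (1 + Q^2 * V^2 * S * x^2 + V * T * U * S * x * (1 + P * T * U * x)
          - Q * V * x * (1 + P * U * S^2 * x^2 * V * T * (-1 + T) * (-1 + U)
                           + S * (1 + P * x + V * T * U * x)))
        / (1 + Q^2 * V^2 * S * x^2 - Q * V * x * (1 + S + P * S * x)))"
proof -
  define x P Q U V S T where "x = (fps_X :: 'a fps)" and "P = fps_const p" and "Q = fps_const q"
    and "U = fps_const u" and "V = fps_const v" and "S = fps_const s" and "T = fps_const t"
  define N where "N = 1 + Q^2 * V^2 * S * x^2 + V * T * U * S * x * (1 + P * T * U * x)
          - Q * V * x * (1 + P * U * S^2 * x^2 * V * T * (-1 + T) * (-1 + U)
                           + S * (1 + P * x + V * T * U * x))"
  define M where "M = 1 + Q^2 * V^2 * S * x^2 - Q * V * x * (1 + S + P * S * x)"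
  define D where "D = 1 - Q * V * x"
  define f g where "f = F 3 p q u v s t" and "g = F 3 p q 1 v s t"
  define Bu Bt B1 But where "Bu = block_gf p q u v s 1" and "Bt = block_gf p q 1 v s t"
    and "B1 = block_gf p q 1 v s 1" and "But = block_gf p q u v s t"
  note defs = x_def P_def Q_def U_def V_def S_def T_def D_def
  have f: "f = 1 + But + Q * Bu * (g - 1)" and g: "g = 1 + Bt + Q * B1 * (g - 1)"
    unfolding f_def g_def But_def Bu_def Bt_def B1_def Q_def by (rule F_3_functional_equation)+
  have But: "D * But = U * T * S * V * x * D + P * U^2 * T^2 * S * V * x^2"
    and Bu: "D * Bu = U * S * V * x * D + P * U^2 * S * V * x^2"
    and Bt: "D * Bt = T * S * V * x * D + P * T^2 * S * V * x^2"
    and B1: "D * B1 = S * V * x * D + P * S * V * x^2"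
    unfolding But_def Bu_def Bt_def B1_def defs block_gf_closed by simp_all
  \<comment> \<open>The claimed denominator is \<open>1 - Q * B1\<close>, the coefficient of
    \<open>g - 1\<close> in its linear equation, multiplied by \<open>D\<close>.\<close>
  have M: "M = D - Q * (D * B1)"
    unfolding B1 by (simp add: M_def D_def algebra_simps power2_eq_square)
  have g': "M * (g - 1) = D * Bt"
    proof -
    have "g - 1 = Bt + Q * B1 * (g - 1)"
      using g by (simp add: algebra_simps)
    then have "D * (g - 1) = D * (Bt + Q * B1 * (g - 1))"
      by (rule arg_cong)
    then show ?thesis
      unfolding M by (simp add: algebra_simps)
  qed
  \<comment> \<open>The factors \<open>D\<close> and \<open>M\<close> are distributed so that each
    unknown series appears in a product whose closed form is known.\<close>
  have "D * (M * f) = M * (D + D * But) + Q * (D * Bu) * (M * (g - 1))"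
    unfolding f by (simp add: algebra_simps)
  also have "\<dots> = M * (D + D * But) + Q * (D * Bu) * (D * Bt)"
    unfolding g' ..
  \<comment> \<open>Only a polynomial identity is left, in which a factor \<open>D\<close> comes
    out.\<close>
  also have "\<dots> = D * N"
    unfolding But Bu Bt unfolding M_def N_def D_def
    by (simp add: algebra_simps power2_eq_square)
  finally have "D * (M * f) = D * N" .
  \<comment> \<open>Both constant terms are 1, so \<open>D\<close> and \<open>M\<close> are nonzero
    and cancel in the integral domain of power series.\<close>
  moreover have "D $ 0 \<noteq> 0" "M $ 0 \<noteq> 0"
    by (simp_all add: D_def M_def x_def fps_mult_nth_0)
  then have "D \<noteq> 0" "M \<noteq> 0"
    by auto
  ultimately have "f = N / M"
    by (metis nonzero_mult_div_cancel_left)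
  then show ?thesis
    unfolding f_def N_def M_def x_def P_def Q_def U_def V_def S_def T_def Let_def .
qed

end
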